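(* Let $1\leq b\leq \frac{n-2}{2}$ and let $T$ be a tree with $n$ vertices and exactly $b$ branching vertices. Then $$SO_{1}(T)\leq \frac{1}{2}\big[(n-2b+1)^{3}-9(n-2b+1)+8(n-b)\big],$$ with equality if and only if $T$ has the degree sequence $$\pi=\{n-2b+1,\underbrace{3,3,\ldots,3}_{b-1},\underbrace{1,1,\ldots,1}_{n-b}\}.$$
   Context: All graphs are finite and simple. For a graph $G$, $d_u$ is the degree of the vertex $u$, and $SO_{1}(G)=\frac{1}{2}\sum_{uv\in E(G)}|d_{u}^{2}-d_{v}^{2}|$. A branching vertex is a vertex of degree at least $3$. *)

theory Defs
  imports Complex_Main "HOL-Library.Multiset"
begin

text \<open>
  A graph is given by its vertex set \<open>V\<close> and a set \<open>E\<close> of two-element subsets of \<open>V\<close>.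
  The trees of the AFP entry Graph-Theory are not suitable: there a graph is a symmetric
  digraph, in which every edge already yields a cycle of length two.
\<close>

definition simple_graph :: "'a set \<Rightarrow> 'a set set \<Rightarrow> bool" where
  "simple_graph V E \<longleftrightarrow> finite V \<and> (\<forall>e\<in>E. e \<subseteq> V \<and> card e = 2)"

definition connected_graph :: "'a set \<Rightarrow> 'a set set \<Rightarrow> bool" where
  "connected_graph V E \<longleftrightarrow>
     V \<noteq> {} \<and> (\<forall>u\<in>V. \<forall>v\<in>V. (u, v) \<in> {(x, y). {x, y} \<in> E}\<^sup>*)"

text \<open>A cycle is the list of its (at least three, pairwise distinct) vertices, in cyclic order.\<close>

definition is_cycle :: "'a set set \<Rightarrow> 'a list \<Rightarrow> bool" where
  "is_cycle E p \<longleftrightarrow> length p \<ge> 3 \<and> distinct p \<and>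
     (\<forall>i < length p. {p ! i, p ! (Suc i mod length p)} \<in> E)"

definition is_tree :: "'a set \<Rightarrow> 'a set set \<Rightarrow> bool" where
  "is_tree V E \<longleftrightarrow> simple_graph V E \<and> connected_graph V E \<and> \<not> (\<exists>p. is_cycle E p)"

definition deg :: "'a set set \<Rightarrow> 'a \<Rightarrow> nat" where
  "deg E v = card {e \<in> E. v \<in> e}"

definition branching_vertices :: "'a set \<Rightarrow> 'a set set \<Rightarrow> 'a set" where
  "branching_vertices V E = {v \<in> V. deg E v \<ge> 3}"

definition degree_sequence :: "'a set \<Rightarrow> 'a set set \<Rightarrow> nat multiset" where
  "degree_sequence V E = image_mset (deg E) (mset_set V)"

text \<open>
  The contribution of an edge is symmetric in its two end vertices, so the description
  below determines it; see \<open>edge_contribution_doubleton\<close>.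
\<close>

definition edge_contribution :: "'a set set \<Rightarrow> 'a set \<Rightarrow> real" where
  "edge_contribution E e =
     (THE x. \<exists>u v. e = {u, v} \<and> x = \<bar>(real (deg E u))\<^sup>2 - (real (deg E v))\<^sup>2\<bar>)"

lemma edge_contribution_doubleton:
  "edge_contribution E {u, v} = \<bar>(real (deg E u))\<^sup>2 - (real (deg E v))\<^sup>2\<bar>"
  unfolding edge_contribution_def
  by (rule the_equality) (auto simp: doubleton_eq_iff abs_minus_commute)

definition SO1 :: "'a set set \<Rightarrow> real" where
  "SO1 E = 1 / 2 * (\<Sum>e\<in>E. edge_contribution E e)"

end

theory Submission
  imports Defs
begin

text \<open>
  An edge with end vertices of degrees \<open>p, q \<ge> 1\<close> contributes at most \<open>h p + h q\<close>, where
  \<open>h d = 8\<close> for \<open>d < 3\<close> and \<open>h d = d\<^sup>2 - 9\<close> otherwise. Summing over the edges bounds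
  \<open>2 SO\<^sub>1\<close> by \<open>\<Sum>\<^sub>v d\<^sub>v h(d\<^sub>v)\<close>, which depends on the degrees only. A branching vertex of degree
  \<open>x + 3\<close> accounts for \<open>f x = x\<^sup>3 + 9 x\<^sup>2 + 18 x\<close>, and as \<open>f\<close> is strictly superadditive, the
  sum is largest when a single vertex carries all the excess \<open>x\<close>. Each vertex of degree two
  lowers the total excess by one, which costs at least 18, while it contributes only 8 more than
  a leaf. Of the
  tree structure, the bound needs only that there are fewer edges than vertices and that no
  vertex is isolated.
\<close>

section \<open>Forests\<close>

lemma simple_graph_finite_edges:
  assumes "simple_graph V E"
  shows "finite E"
  using assms finite_subset[of E "Pow V"] by (auto simp: simple_graph_def)

text \<open>The start \<open>v\<close> of a longest path has this property. A second edge at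
  \<open>v\<close> leads to some \<open>w\<close> that lies on the path, as otherwise
  \<open>w # p\<close> would be longer; the prefix ending in \<open>w\<close> then closes to a
  cycle.\<close>

lemma acyclic_imp_deg_le_one:
  assumes G: "simple_graph V E" and "V \<noteq> {}" and acyc: "\<nexists>p. is_cycle E p"
  shows "\<exists>v\<in>V. deg E v \<le> 1"
proof -
  define P where "P = (\<lambda>p. p \<noteq> [] \<and> distinct p \<and> set p \<subseteq> V \<and>
    (\<forall>i. Suc i < length p \<longrightarrow> {p ! i, p ! Suc i} \<in> E))"
  have fV: "finite V" using G by (simp add: simple_graph_def)
  obtain a where "a \<in> V" using \<open>V \<noteq> {}\<close> by blast
  then have "P [a]" by (simp add: P_def)
  moreover have "\<forall>p. P p \<longrightarrow> length p < Suc (card V)"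
  proof (intro allI impI)
    fix p assume "P p"
    then have "length p = card (set p)" "set p \<subseteq> V" by (auto simp: P_def distinct_card)
    then show "length p < Suc (card V)" using card_mono[OF fV, of "set p"] by simp
  qed
  ultimately obtain p where p: "P p" and longest: "\<And>q. P q \<Longrightarrow> length q \<le> length p"
    using ex_has_greatest_nat[of P "[a]" length] by blast
  define v where "v = p ! 0"
  have vV: "v \<in> V" using p by (auto simp: P_def v_def)
  have "deg E v \<le> 1"
  proof (rule ccontr)
    assume "\<not> deg E v \<le> 1"
    then have "card {e \<in> E. v \<in> e} \<ge> 2" by (simp add: deg_def)
    \<comment> \<open>If \<open>p\<close> has a single vertex, \<open>p ! 1\<close> is an
      unspecified value. This does no harm: the index \<open>k\<close> found below is then 0, which
      already contradicts \<open>w \<noteq> v\<close>.\<close>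
    then have "\<not> {e \<in> E. v \<in> e} \<subseteq> {{v, p ! 1}}"
      using card_mono[of "{{v, p ! 1}}" "{e \<in> E. v \<in> e}"] by auto
    then obtain e where e: "e \<in> E" "v \<in> e" "e \<noteq> {v, p ! 1}" by blast
    have "card e = 2" "e \<subseteq> V" using G e by (auto simp: simple_graph_def)
    then obtain w where w: "e = {v, w}" "w \<noteq> v" using e(2)
      by (auto simp: card_2_iff)
    have "w \<noteq> p ! 1" using e w by auto
    have "w \<in> set p"
    proof (rule ccontr)
      assume "w \<notin> set p"
      then have "P (w # p)"
        using p e w \<open>e \<subseteq> V\<close>
        by (auto simp: P_def v_def nth_Cons insert_commute split: nat.splits)
      then show False using longest by fastforce
    qed
    then obtain k where k: "k < length p" "w = p ! k" by (auto simp: in_set_conv_nth)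
    have "k \<noteq> 0" using k \<open>w \<noteq> v\<close> by (metis v_def)
    moreover have "k \<noteq> 1" using k \<open>w \<noteq> p ! 1\<close> by metis
    ultimately have k2: "k \<ge> 2" by linarith
    have "is_cycle E (take (Suc k) p)"
      unfolding is_cycle_def
    proof (intro conjI allI impI)
      show "3 \<le> length (take (Suc k) p)" using k k2 by simp
      show "distinct (take (Suc k) p)" using p by (simp add: P_def)
      fix i assume "i < length (take (Suc k) p)"
      then have i: "i \<le> k" using k by simp
      have len: "length (take (Suc k) p) = Suc k" using k by simp
      show "{take (Suc k) p ! i, take (Suc k) p ! (Suc i mod length (take (Suc k) p))} \<in> E"
      proof (cases "i = k")
        case True
        then show ?thesis unfolding len using e w k by (simp add: v_def insert_commute)
      next
        case False
        then show ?thesis unfolding len using i p k by (simp add: P_def)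
      qed
    qed
    then show False using acyc by blast
  qed
  then show ?thesis using vV by blast
qed

text \<open>Induction on the number of vertices: deleting a vertex of degree at most one removes at
  most one edge and creates no cycle.\<close>

lemma acyclic_card_edges_less:
  assumes "simple_graph V E" and "V \<noteq> {}" and "\<nexists>p. is_cycle E p"
  shows "card E < card V"
  using assms
proof (induction "card V" arbitrary: V E)
  case 0
  then show ?case by (simp add: simple_graph_def)
next
  case (Suc n)
  have fV: "finite V" and fE: "finite E"
    using Suc.prems simple_graph_finite_edges by (auto simp: simple_graph_def)
  obtain v where v: "v \<in> V" "deg E v \<le> 1" using acyclic_imp_deg_le_one Suc.prems by blast
  let ?V = "V - {v}" and ?E = "E - {e \<in> E. v \<in> e}"
  have G: "simple_graph ?V ?E" using Suc.prems by (auto simp: simple_graph_def)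
  have cV: "card ?V = n" using v Suc.hyps fV by simp
  have cE: "card ?E = card E - deg E v" using fE by (simp add: deg_def card_Diff_subset)
  show ?case
  proof (cases "?V = {}")
    case True
    then have "V = {v}" using v by blast
    have "E = {}"
    proof (rule ccontr)
      assume "E \<noteq> {}"
      then obtain e where "e \<subseteq> V" "card e = 2"
        using Suc.prems by (auto simp: simple_graph_def)
      then show False using card_mono[of "{v}" e] \<open>V = {v}\<close> by simp
    qed
    then show ?thesis using Suc.hyps by simp
  next
    case False
    have "\<nexists>p. is_cycle ?E p" using Suc.prems by (auto simp: is_cycle_def)
    then have "card ?E < card ?V" using Suc.hyps(1)[OF _ G False] cV by simp
    then show ?thesis using cE cV v Suc.hyps(2) by linarith
  qed
qed

section \<open>Connected graphs\<close>

lemma connected_deg_pos: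
  assumes G: "simple_graph V E" and "connected_graph V E" and "card V \<ge> 2" and "v \<in> V"
  shows "deg E v \<ge> 1"
proof -
  have "\<not> V \<subseteq> {v}" using card_mono[of "{v}" V] assms(3) by auto
  then obtain u where "u \<in> V" "u \<noteq> v" by blast
  then have "(v, u) \<in> {(x, y). {x, y} \<in> E}\<^sup>*" using assms by (simp add: connected_graph_def)
  then obtain y where "{v, y} \<in> E" using \<open>u \<noteq> v\<close> by (cases rule: converse_rtranclE) auto
  then have "{e \<in> E. v \<in> e} \<noteq> {}" by auto
  then show ?thesis
    using simple_graph_finite_edges[OF G] by (simp add: deg_def Suc_le_eq card_gt_0_iff)
qed

lemma deg_eq_1_unique_edge:
  assumes "deg E v = 1" and "e \<in> E" "v \<in> e" and "e' \<in> E" "v \<in> e'"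
  shows "e = e'"
proof -
  obtain a where "{e \<in> E. v \<in> e} = {a}"
    using assms(1) unfolding deg_def by (rule card_1_singletonE)
  then have "e = a" "e' = a" using assms(2-) by auto
  then show ?thesis by simp
qed

text \<open>Two adjacent leaves would form a component of their own. Such an edge has to be excluded
  for equality: it contributes 0, while its ends have total weight 16.\<close>

lemma connected_no_leaf_leaf_edge:
  assumes "simple_graph V E" and "connected_graph V E" and "card V \<ge> 3" and uv: "{u, v} \<in> E"
  shows "\<not> (deg E u = 1 \<and> deg E v = 1)"
proof
  assume leaves: "deg E u = 1 \<and> deg E v = 1"
  have "card {u, v} \<le> 2" by (simp add: card_insert_if)
  have "\<not> V \<subseteq> {u, v}" using card_mono[of "{u, v}" V] \<open>card {u, v} \<le> 2\<close> assms(3) by force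
  then obtain w where w: "w \<in> V" "w \<notin> {u, v}" by blast
  have "u \<in> V" using assms by (auto simp: simple_graph_def)
  then have "(u, w) \<in> {(x, y). {x, y} \<in> E}\<^sup>*" using w assms by (simp add: connected_graph_def)
  \<comment> \<open>No walk from \<open>u\<close> leaves \<open>{u, v}\<close>, since
    \<open>{u, v}\<close> is the only edge at either end.\<close>
  then have "w \<in> {u, v}"
  proof (induction rule: rtrancl_induct)
    case (step y z)
    then have "{y, z} \<in> E" "deg E y = 1" "y \<in> {u, v}" using leaves by auto
    then have "{y, z} = {u, v}" using deg_eq_1_unique_edge[of E y "{y, z}"] uv by simp
    then show ?case by blast
  qed simp
  then show False using w by blast
qed

section \<open>Edge contributions and degrees\<close>

text \<open>Double counting of incident pairs: a vertex is met once for each of its edges.\<close>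

lemma sum_edges_vertices:
  fixes g :: "'a \<Rightarrow> real"
  assumes G: "simple_graph V E"
  shows "(\<Sum>e\<in>E. \<Sum>v\<in>e. g v) = (\<Sum>v\<in>V. real (deg E v) * g v)"
proof -
  have fV: "finite V" and fE: "finite E"
    using G simple_graph_finite_edges by (auto simp: simple_graph_def)
  have "(\<Sum>e\<in>E. \<Sum>v\<in>e. g v) = (\<Sum>e\<in>E. \<Sum>v | v \<in> V \<and> v \<in> e. g v)"
    using G by (intro sum.cong) (auto simp: simple_graph_def intro!: sum.cong)
  also have "\<dots> = (\<Sum>v\<in>V. \<Sum>e | e \<in> E \<and> v \<in> e. g v)"
    by (rule sum.swap_restrict[OF fE fV])
  finally show ?thesis by (simp add: deg_def)
qed

lemma handshake:
  assumes G: "simple_graph V E"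
  shows "(\<Sum>v\<in>V. deg E v) = 2 * card E"
proof -
  have "real (\<Sum>v\<in>V. deg E v) = (\<Sum>e\<in>E. \<Sum>v\<in>e. 1)"
    using sum_edges_vertices[OF G, of "\<lambda>_. 1"] by simp
  also have "\<dots> = (\<Sum>e\<in>E. 2)"
    using G by (intro sum.cong) (auto simp: simple_graph_def)
  finally have "real (\<Sum>v\<in>V. deg E v) = real (2 * card E)" by simp
  then show ?thesis by (simp only: of_nat_eq_iff)
qed

definition degree_weight :: "nat \<Rightarrow> real" where
  "degree_weight d = (if d < 3 then 8 else (real d)\<^sup>2 - 9)"

lemma nine_le_square: "(9::real) \<le> (real d)\<^sup>2" if "d \<ge> 3"
  using power_mono[of 3 "real d" 2] that by simp

text \<open>If both degrees are at least 3, the smaller square is at least 9. If only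
  \<open>p\<close> is, then \<open>q\<^sup>2\<close> is at least 1 and p^2 - 1 = (p^2 - 9) + 8. If
  neither is, the right side is 16 and both squares lie between 1 and 9.\<close>

lemma abs_diff_squares_le_degree_weight:
  assumes "p \<ge> 1" "q \<ge> 1"
  shows "\<bar>(real p)\<^sup>2 - (real q)\<^sup>2\<bar> \<le> degree_weight p + degree_weight q"
proof -
  have 1: "1 \<le> (real d)\<^sup>2" if "d \<ge> 1" for d using that by simp
  have 4: "(real d)\<^sup>2 < 9" if "d < 3" for d
    using that power_strict_mono[of "real d" 3 2] by simp
  show ?thesis
    using 1[of p] 1[of q] 4[of p] 4[of q] nine_le_square[of p] nine_le_square[of q] assms
    unfolding degree_weight_def by (smt (verit) not_le)
qed

text \<open>These pairs are tight because degree 3 has weight 0, and a leaf end supplies the 8 by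
  which p^2 - 1 exceeds p^2 - 9.\<close>

lemma abs_diff_squares_eq_degree_weight:
  assumes "p = 1 \<or> p \<ge> 3" "q = 1 \<or> q \<ge> 3" "\<not> (p = 1 \<and> q = 1)" "p \<le> 3 \<or> q \<le> 3"
  shows "\<bar>(real p)\<^sup>2 - (real q)\<^sup>2\<bar> = degree_weight p + degree_weight q"
proof -
  have "p = 1 \<and> q \<ge> 3 \<or> q = 1 \<and> p \<ge> 3 \<or> p = 3 \<and> q \<ge> 3 \<or> q = 3 \<and> p \<ge> 3"
    using assms by linarith
  then show ?thesis
    using nine_le_square[of p] nine_le_square[of q] by (auto simp: degree_weight_def)
qed

lemma edge_doubleton:
  assumes "simple_graph V E" "e \<in> E"
  obtains u v where "e = {u, v}" "u \<noteq> v" "u \<in> V" "v \<in> V"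
  using assms by (fastforce simp: simple_graph_def card_2_iff)

lemma SO1_le_degree_sum:
  assumes G: "simple_graph V E" and pos: "\<And>v. v \<in> V \<Longrightarrow> deg E v \<ge> 1"
  shows "2 * SO1 E \<le> (\<Sum>v\<in>V. real (deg E v) * degree_weight (deg E v))"
proof -
  have "2 * SO1 E = (\<Sum>e\<in>E. edge_contribution E e)" by (simp add: SO1_def)
  also have "\<dots> \<le> (\<Sum>e\<in>E. \<Sum>v\<in>e. degree_weight (deg E v))"
  proof (rule sum_mono)
    fix e assume "e \<in> E"
    then obtain u v where "e = {u, v}" "u \<noteq> v" "u \<in> V" "v \<in> V"
      using edge_doubleton[OF G] by blast
    then show "edge_contribution E e \<le> (\<Sum>v\<in>e. degree_weight (deg E v))"
      using abs_diff_squares_le_degree_weight pos by (simp add: edge_contribution_doubleton)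
  qed
  finally show ?thesis using sum_edges_vertices[OF G] by simp
qed

text \<open>This serves the converse direction of the equality case: under these conditions on the
  degrees every edge is tight, however the tree is arranged.\<close>

lemma SO1_eq_degree_sum:
  assumes G: "simple_graph V E" and conn: "connected_graph V E" and n: "card V \<ge> 3"
    and no2: "\<And>v. v \<in> V \<Longrightarrow> deg E v = 1 \<or> deg E v \<ge> 3"
    and large: "\<And>u v. u \<in> V \<Longrightarrow> v \<in> V \<Longrightarrow> u \<noteq> v \<Longrightarrow> deg E u \<le> 3 \<or> deg E v \<le> 3"
  shows "2 * SO1 E = (\<Sum>v\<in>V. real (deg E v) * degree_weight (deg E v))"
proof -
  have "2 * SO1 E = (\<Sum>e\<in>E. edge_contribution E e)" by (simp add: SO1_def)
  also have "\<dots> = (\<Sum>e\<in>E. \<Sum>v\<in>e. degree_weight (deg E v))"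
  proof (rule sum.cong)
    fix e assume e: "e \<in> E"
    then obtain u v where uv: "e = {u, v}" "u \<noteq> v" "u \<in> V" "v \<in> V"
      using edge_doubleton[OF G] by blast
    then show "edge_contribution E e = (\<Sum>v\<in>e. degree_weight (deg E v))"
      using abs_diff_squares_eq_degree_weight[OF no2[of u] no2[of v]] large
        connected_no_leaf_leaf_edge[OF G conn n] e
      by (simp add: edge_contribution_doubleton)
  qed simp
  finally show ?thesis using sum_edges_vertices[OF G] by simp
qed

section \<open>The excess of the branching vertices\<close>

text \<open>This is d^3 - 9 d at d = x + 3. In terms of the excess all coefficients are nonnegative,
  so the estimates can be made in \<open>nat\<close> without subtraction.\<close>

definition excess_poly :: "nat \<Rightarrow> nat" where
  "excess_poly x = x ^ 3 + 9 * x\<^sup>2 + 18 * x"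

lemma excess_poly_shift:
  "real (excess_poly x) = real (x + 3) ^ 3 - 9 * real (x + 3)"
  by (simp add: excess_poly_def algebra_simps power2_eq_square power3_eq_cube)

lemma degree_mult_degree_weight:
  assumes "d \<ge> 3"
  shows "real d * degree_weight d = real (excess_poly (d - 3))"
  using assms unfolding excess_poly_shift
  by (simp add: degree_weight_def algebra_simps power2_eq_square power3_eq_cube)

text \<open>The cubic and quadratic terms are monotone, and the linear term alone has slope
  18.\<close>

lemma excess_poly_growth:
  assumes "x \<le> y"
  shows "excess_poly x + 18 * (y - x) \<le> excess_poly y"
proof -
  have "x ^ 3 \<le> y ^ 3" "x\<^sup>2 \<le> y\<^sup>2" using assms by (simp_all add: power_mono)
  then show ?thesis using assms unfolding excess_poly_def by linarith
qed

text \<open>The quotient of \<open>excess_poly x\<close> by \<open>x\<close> is increasing; the form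
  without division also covers \<open>x = 0\<close>.\<close>

lemma excess_poly_le_mult: "excess_poly x \<le> x * (X\<^sup>2 + 9 * X + 18)" if "x \<le> X"
proof -
  have "excess_poly x = x * (x\<^sup>2 + 9 * x + 18)"
    by (simp add: excess_poly_def algebra_simps power2_eq_square power3_eq_cube)
  moreover have "x\<^sup>2 \<le> X\<^sup>2" using that by (simp add: power_mono)
  then have "x\<^sup>2 + 9 * x + 18 \<le> X\<^sup>2 + 9 * X + 18" using that by linarith
  ultimately show ?thesis using that by simp
qed

lemma excess_poly_less_mult: "excess_poly x < x * (X\<^sup>2 + 9 * X + 18)" if "x < X" "x > 0"
proof -
  have "excess_poly x = x * (x\<^sup>2 + 9 * x + 18)"
    by (simp add: excess_poly_def algebra_simps power2_eq_square power3_eq_cube)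
  moreover have "x\<^sup>2 \<le> X\<^sup>2" using that by (simp add: power_mono)
  then have "x\<^sup>2 + 9 * x + 18 < X\<^sup>2 + 9 * X + 18" using that by linarith
  ultimately show ?thesis using that by simp
qed

text \<open>The value at the total is divided among the summands in proportion to
  \<open>x v\<close>, so that superadditivity can be checked one summand at a time.\<close>

lemma excess_poly_as_sum:
  "excess_poly (sum x B) = (\<Sum>v\<in>B. x v * ((sum x B)\<^sup>2 + 9 * sum x B + 18))"
  unfolding sum_distrib_right[symmetric]
  by (simp add: excess_poly_def algebra_simps power2_eq_square power3_eq_cube)

lemma excess_poly_sum_le:
  assumes "finite B"
  shows "(\<Sum>v\<in>B. excess_poly (x v)) \<le> excess_poly (sum x B)"
  unfolding excess_poly_as_sum
  using assms by (intro sum_mono excess_poly_le_mult) (simp add: member_le_sum)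

text \<open>A summand strictly between 0 and the total would make its own comparison strict.\<close>

lemma excess_poly_sum_eqD:
  assumes "finite B" and eq: "(\<Sum>v\<in>B. excess_poly (x v)) = excess_poly (sum x B)" and "v \<in> B"
  shows "x v = 0 \<or> x v = sum x B"
proof (rule ccontr)
  assume contr: "\<not> ?thesis"
  have le: "x u \<le> sum x B" if "u \<in> B" for u
    using that assms(1) by (simp add: member_le_sum)
  have "(\<Sum>v\<in>B. excess_poly (x v)) < excess_poly (sum x B)"
    unfolding excess_poly_as_sum
  proof (rule sum_strict_mono_ex1[OF assms(1)])
    show "\<forall>u\<in>B. excess_poly (x u) \<le> x u * ((sum x B)\<^sup>2 + 9 * sum x B + 18)"
      using le excess_poly_le_mult by blast
    show "\<exists>u\<in>B. excess_poly (x u) < x u * ((sum x B)\<^sup>2 + 9 * sum x B + 18)"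
      using contr le[OF \<open>v \<in> B\<close>] \<open>v \<in> B\<close> by (intro bexI[of _ v] excess_poly_less_mult) auto
  qed
  then show False using eq by simp
qed

section \<open>The bound and the extremal degree sequence\<close>

lemma image_mset_set_const:
  assumes "finite A" and "\<And>v. v \<in> A \<Longrightarrow> g v = c"
  shows "image_mset g (mset_set A) = replicate_mset (card A) c"
proof -
  have "image_mset g (mset_set A) = image_mset (\<lambda>_. c) (mset_set A)"
    using assms by (intro image_mset_cong) simp
  then show ?thesis by (simp add: image_mset_const_eq)
qed

theorem theorem6p8:
  fixes V :: "'a set" and E :: "'a set set" and n b :: nat
  assumes "1 \<le> b" and "real b \<le> (real n - 2) / 2"
    and "is_tree V E" and "card V = n"
    and "card (branching_vertices V E) = b"
  shows "SO1 E \<le> 1 / 2 * ((real n - 2 * real b + 1) ^ 3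
                          - 9 * (real n - 2 * real b + 1) + 8 * (real n - real b)) \<and>
    (SO1 E = 1 / 2 * ((real n - 2 * real b + 1) ^ 3
                      - 9 * (real n - 2 * real b + 1) + 8 * (real n - real b)) \<longleftrightarrow>
     degree_sequence V E =
       {#n - 2 * b + 1#} + replicate_mset (b - 1) 3 + replicate_mset (n - b) 1)"
proof -
  have G: "simple_graph V E" and conn: "connected_graph V E" and acyc: "\<nexists>p. is_cycle E p"
    using assms by (auto simp: is_tree_def)
  have fV: "finite V" using G by (simp add: simple_graph_def)
  have "real (2 * b + 2) \<le> real n" using assms(2) by simp
  then have nb: "2 * b + 2 \<le> n" by linarith
  have pos: "deg E v \<ge> 1" if "v \<in> V" for v
    using connected_deg_pos[OF G conn _ that] assms(4) nb by simp
  define B where "B = branching_vertices V E"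
  define W where "W = {v \<in> V. deg E v = 2}"
  define L where "L = {v \<in> V. deg E v = 1}"
  have fin: "finite B" "finite W" "finite L"
    using fV by (auto simp: B_def W_def L_def branching_vertices_def)
  have BWL: "V = B \<union> (W \<union> L)" "B \<inter> (W \<union> L) = {}" "W \<inter> L = {}"
    using pos by (fastforce simp: B_def W_def L_def branching_vertices_def)+
  have B3: "deg E v \<ge> 3" if "v \<in> B" for v using that by (simp add: B_def branching_vertices_def)
  have split: "sum g V = sum g B + (sum g W + sum g L)" for g :: "'a \<Rightarrow> 'c::comm_monoid_add"
    using fin BWL by (simp add: sum.union_disjoint)
  have cB: "card B = b" using assms(5) by (simp add: B_def)
  have cV: "b + card W + card L = n"
    using split[of "\<lambda>_. 1 :: nat"] assms(4) cB by simp
  \<comment> \<open>\<open>N\<close> is the largest possible total excess: the degree sum is at most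
    2 (n - 1), branching vertices use at least 3 each, and the other n - b vertices at least 1 each.
    The subtractions here and in \<open>x\<close> on \<open>B\<close> do not truncate, by
    \<open>nb\<close> and \<open>B3\<close>.\<close>
  define N where "N = n - 2 * b - 2"
  define x where "x = (\<lambda>v. deg E v - 3)"
  define X where "X = sum x B"
  have "(\<Sum>v\<in>V. deg E v) = (\<Sum>v\<in>B. deg E v) + 2 * card W + card L"
    unfolding split by (simp add: W_def L_def)
  moreover have "(\<Sum>v\<in>B. deg E v) = X + 3 * b"
  proof -
    have "(\<Sum>v\<in>B. deg E v) = (\<Sum>v\<in>B. x v + 3)"
      using B3 by (intro sum.cong) (auto simp: x_def)
    then show ?thesis by (simp add: X_def sum.distrib cB)
  qed
  moreover have "card E < card V"
    using acyclic_card_edges_less[OF G _ acyc] nb assms(4) by fastforce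
  ultimately have XN: "X + card W \<le> N"
    using handshake[OF G] cV nb assms(4) by (simp add: N_def)
  have nD: "n - 2 * b + 1 = N + 3" using nb by (simp add: N_def)
  have D: "real n - 2 * real b + 1 = real (N + 3)" using nb by (simp add: N_def of_nat_diff)
  have bound: "1 / 2 * ((real n - 2 * real b + 1) ^ 3 - 9 * (real n - 2 * real b + 1)
      + 8 * (real n - real b)) = (real (excess_poly N) + 8 * real (n - b)) / 2"
    unfolding D excess_poly_shift using nb by (simp add: of_nat_diff)
  have wsum: "(\<Sum>v\<in>V. real (deg E v) * degree_weight (deg E v)) =
      real ((\<Sum>v\<in>B. excess_poly (x v)) + 16 * card W + 8 * card L)"
  proof -
    have "(\<Sum>v\<in>B. real (deg E v) * degree_weight (deg E v)) = real (\<Sum>v\<in>B. excess_poly (x v))"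
      using B3 by (simp add: degree_mult_degree_weight x_def)
    moreover have "(\<Sum>v\<in>W. real (deg E v) * degree_weight (deg E v)) = 16 * card W"
      by (simp add: W_def degree_weight_def)
    moreover have "(\<Sum>v\<in>L. real (deg E v) * degree_weight (deg E v)) = 8 * card L"
      by (simp add: L_def degree_weight_def)
    ultimately show ?thesis unfolding split by simp
  qed
  have le: "2 * SO1 E \<le> real ((\<Sum>v\<in>B. excess_poly (x v)) + 16 * card W + 8 * card L)"
    using SO1_le_degree_sum[OF G pos] wsum by simp
  have le1: "(\<Sum>v\<in>B. excess_poly (x v)) \<le> excess_poly X"
    unfolding X_def by (rule excess_poly_sum_le[OF fin(1)])
  have le2: "excess_poly X + 18 * (N - X) \<le> excess_poly N"
    using XN by (intro excess_poly_growth) simp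
  have cL: "n - b = card W + card L" using cV by simp
  \<comment> \<open>The vertices of \<open>W\<close> exceed \<open>8 * (n - b)\<close> by
    \<open>8 * card W\<close> in total, and \<open>N - X\<close> is at least \<open>card W\<close>,
    so the 18 per unit in \<open>le2\<close> pays for this.\<close>
  have "(\<Sum>v\<in>B. excess_poly (x v)) + 16 * card W + 8 * card L \<le> excess_poly N + 8 * (n - b)"
    using le1 le2 XN cL by simp
  then have le3: "real ((\<Sum>v\<in>B. excess_poly (x v)) + 16 * card W + 8 * card L) \<le>
      real (excess_poly N + 8 * (n - b))"
    by (simp only: of_nat_le_iff)
  have upper: "SO1 E \<le> (real (excess_poly N) + 8 * real (n - b)) / 2"
    using le le3 by simp
  have "SO1 E = (real (excess_poly N) + 8 * real (n - b)) / 2 \<longleftrightarrow>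
     degree_sequence V E = {#N + 3#} + replicate_mset (b - 1) 3 + replicate_mset (n - b) 1"
  proof
    assume "SO1 E = (real (excess_poly N) + 8 * real (n - b)) / 2"
    then have "real (excess_poly N + 8 * (n - b)) \<le>
        real ((\<Sum>v\<in>B. excess_poly (x v)) + 16 * card W + 8 * card L)"
      using le by simp
    then have ge: "excess_poly N + 8 * (n - b) \<le>
        (\<Sum>v\<in>B. excess_poly (x v)) + 16 * card W + 8 * card L"
      by (simp only: of_nat_le_iff)
    \<comment> \<open>The slack is at least 18 (N - X) - 8 \<open>card W\<close>, hence at least 10
      (N - X). Its vanishing gives \<open>X = N\<close>, and then \<open>XN\<close> leaves no room
      for \<open>W\<close>.\<close>
    then have W0: "card W = 0" and "X = N" and eq: "(\<Sum>v\<in>B. excess_poly (x v)) = excess_poly X"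
      using le1 le2 XN cL by linarith+
    have x0: "x v = 0 \<or> x v = N" if "v \<in> B" for v
      using excess_poly_sum_eqD[OF fin(1) eq[unfolded X_def] that] \<open>X = N\<close> X_def by simp
    have "\<exists>v\<in>B. x v = N"
    \<comment> \<open>If \<open>N = 0\<close>, all branching vertices have degree 3 and any of them
      serves as \<open>v\<close>; one exists because \<open>b\<close> is positive.\<close>
    proof (cases "N = 0")
      case True
      moreover have "B \<noteq> {}" using cB assms(1) by auto
      ultimately show ?thesis using x0 by blast
    next
      case False
      then show ?thesis using x0 \<open>X = N\<close> X_def by (metis sum.neutral)
    qed
    then obtain v where v: "v \<in> B" "x v = N" by blast
    have rest: "sum x (B - {v}) = 0"
      using sum.remove[OF fin(1) v(1), of x] v \<open>X = N\<close> X_def by simp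
    have degv: "deg E v = N + 3" using v B3[of v] by (simp add: x_def)
    have "deg E u = 3" if "u \<in> B - {v}" for u
      using rest that fin(1) B3[of u] by (auto simp: x_def intro: le_antisym)
    then have *: "image_mset (deg E) (mset_set (B - {v})) = replicate_mset (b - 1) 3"
      using cB v fin by (subst image_mset_set_const[where c = 3]) simp_all
    have **: "image_mset (deg E) (mset_set L) = replicate_mset (n - b) 1"
      using cL W0 fin(3) by (subst image_mset_set_const[where c = 1]) (simp_all add: L_def)
    have V: "V = insert v ((B - {v}) \<union> L)" using BWL(1) v W0 fin by auto
    have "v \<notin> (B - {v}) \<union> L" "(B - {v}) \<inter> L = {}" using BWL(2) v by auto
    then have "mset_set V = {#v#} + mset_set (B - {v}) + mset_set L"
      using fin unfolding V by (subst mset_set.insert) (simp_all add: mset_set_Union)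
    then show "degree_sequence V E =
        {#N + 3#} + replicate_mset (b - 1) 3 + replicate_mset (n - b) 1"
      by (simp add: degree_sequence_def * ** degv)
  next
    assume ds: "degree_sequence V E =
        {#N + 3#} + replicate_mset (b - 1) 3 + replicate_mset (n - b) 1"
    have degs: "deg E v \<in> {N + 3, 3, 1}" if "v \<in> V" for v
    proof -
      have "deg E v \<in># degree_sequence V E" using that fV by (simp add: degree_sequence_def)
      then show ?thesis unfolding ds by (auto split: if_splits)
    qed
    have large: "deg E u \<le> 3 \<or> deg E v \<le> 3" if "u \<in> V" "v \<in> V" "u \<noteq> v" for u v
    proof (rule ccontr)
      assume "\<not> ?thesis"
      then have uv: "deg E u = N + 3" "deg E v = N + 3" "N > 0"
        using degs[of u] degs[of v] that by auto
      \<comment> \<open>For positive \<open>N\<close> the value \<open>N + 3\<close> occurs only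
        once in the prescribed sequence, whereas \<open>u\<close> and \<open>v\<close> would account
        for two occurrences.\<close>
      have "mset_set {u, v} \<subseteq># mset_set V"
        using that fV by (intro subset_imp_msubset_mset_set) auto
      then have "image_mset (deg E) (mset_set {u, v}) \<subseteq># degree_sequence V E"
        unfolding degree_sequence_def by (rule image_mset_subseteq_mono)
      then have "count (image_mset (deg E) (mset_set {u, v})) (N + 3)
          \<le> count (degree_sequence V E) (N + 3)"
        by (rule mset_subset_eq_count)
      then show False using uv that(3) by (simp add: ds)
    qed
    have "deg E v = 1 \<or> deg E v \<ge> 3" if "v \<in> V" for v using degs[OF that] by auto
    moreover have "card V \<ge> 3" using nb assms(1,4) by simp
    ultimately have "2 * SO1 E = (\<Sum>v\<in>V. real (deg E v) * degree_weight (deg E v))"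
      using SO1_eq_degree_sum[OF G conn] large by blast
    \<comment> \<open>The degree sum depends on the multiset of degrees alone, so it can be
      evaluated on \<open>ds\<close>: entries 3 give 0 and entries 1 give 8.\<close>
    also have "\<dots> = sum_mset (image_mset (\<lambda>d. real d * degree_weight d) (degree_sequence V E))"
      by (simp add: degree_sequence_def sum_unfold_sum_mset multiset.map_comp comp_def)
    also have "\<dots> = real (excess_poly N) + 8 * real (n - b)"
      unfolding ds using degree_mult_degree_weight[of "N + 3"]
      by (simp add: degree_weight_def)
    finally show "SO1 E = (real (excess_poly N) + 8 * real (n - b)) / 2" by simp
  qed
  then show ?thesis using upper unfolding bound nD by simp
qed

end
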